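(* Let $m=2$ and let $n>2$ be an integer. Then there exist designs $(A,c)$ with $A\in\mathbb{R}_{\ge 0}^{2\times n}$ and $c\in\mathbb{R}_{\ge 0}^n$ that satisfy $|\mathcal{L}^2(A,c)|\ge n-1$.
   Context: For $A\in\mathbb{R}_{\ge0}^{m\times n}$, $c\in\mathbb{R}_{\ge0}^n$, $b\in\mathbb{R}_{\ge0}^m$, let $LP(A,c,b)$ be the linear program $\max\{c^\top x \mid Ax\le b,\ x\ge 0\}$. The pair $(A,c)$ is called a design. For $x\in\mathbb{R}^n_{\ge0}$, $\mathrm{supp}(x)=\{i\in[n]\mid x_i>0\}$, where $[n]=\{1,\dots,n\}$. A set $L\subseteq[n]$ is a loadout of $(A,c)$ if there exists $b\in\mathbb{R}^m_{\ge 0}$ such that $LP(A,c,b)$ has a unique optimal solution $x^*$ and $\mathrm{supp}(x^* )=L$. A loadout with $|L|=k$ is a $k$-loadout, and $\mathcal{L}^k(A,c)$ is the set of all $k$-loadouts of $(A,c)$. *)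

theory Defs
  imports Complex_Main "Jordan_Normal_Form.Matrix"
begin

text \<open>
  The linear program LP(A,c,b) maximises \<open>c \<bullet> x\<close> subject to \<open>A *\<^sub>v x \<le> b\<close> and \<open>x \<ge> 0\<close>;
  the order on vectors is the componentwise one.
  Coordinates are numbered from 0, so the index set [n] is rendered as \<open>{0..<n}\<close>.
\<close>

definition design :: "nat \<Rightarrow> nat \<Rightarrow> real mat \<Rightarrow> real vec \<Rightarrow> bool" where
  "design m n A c \<longleftrightarrow>
     A \<in> carrier_mat m n \<and> (\<forall>i<m. \<forall>j<n. A $$ (i, j) \<ge> 0) \<and>
     c \<in> carrier_vec n \<and> 0\<^sub>v n \<le> c"

definition lp_feasible :: "real mat \<Rightarrow> real vec \<Rightarrow> real vec set" where
  "lp_feasible A b = {x \<in> carrier_vec (dim_col A). A *\<^sub>v x \<le> b \<and> 0\<^sub>v (dim_col A) \<le> x}"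

definition lp_optimal :: "real mat \<Rightarrow> real vec \<Rightarrow> real vec \<Rightarrow> real vec \<Rightarrow> bool" where
  "lp_optimal A c b x \<longleftrightarrow> x \<in> lp_feasible A b \<and> (\<forall>y \<in> lp_feasible A b. c \<bullet> y \<le> c \<bullet> x)"

definition supp :: "real vec \<Rightarrow> nat set" where
  "supp x = {i \<in> {0..<dim_vec x}. x $ i > 0}"

definition loadout :: "real mat \<Rightarrow> real vec \<Rightarrow> nat set \<Rightarrow> bool" where
  "loadout A c L \<longleftrightarrow> L \<subseteq> {0..<dim_col A} \<and>
     (\<exists>b \<in> carrier_vec (dim_row A). 0\<^sub>v (dim_row A) \<le> b \<and>
        (\<exists>x. lp_optimal A c b x \<and> (\<forall>y. lp_optimal A c b y \<longrightarrow> y = x) \<and> supp x = L))"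

definition k_loadouts :: "nat \<Rightarrow> real mat \<Rightarrow> real vec \<Rightarrow> nat set set" where
  "k_loadouts k A c = {L. loadout A c L \<and> card L = k}"

end

theory Submission
  imports Defs
begin

text \<open>
  The columns are the points (1, j) and the objective \<open>c\<^sub>j = 1 + 2nj - j\<^sup>2\<close> is strictly concave
  in j. The line \<open>p + q j\<close> through \<open>(k, c\<^sub>k)\<close> and \<open>(k+1, c\<^sub>k\<^sub>+\<^sub>1)\<close> exceeds \<open>c\<^sub>j\<close> by
  \<open>(j - k) (j - k - 1)\<close>, which is positive for the other integers j, and it has \<open>p, q > 0\<close>. So
  \<open>(p, q)\<close> is a dual certificate for the right-hand side \<open>(2, 2k+1)\<close>: complementary slackness
  makes \<open>e\<^sub>k + e\<^sub>k\<^sub>+\<^sub>1\<close> the unique optimum, and \<open>{k, k+1}\<close> is a loadout for each \<open>k < n - 1\<close>.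
\<close>

text \<open>Since \<open>0 ^ 0 = 1\<close>, column 0 is (1, 0), in line with the other
  columns.\<close>

definition moment_mat :: "nat \<Rightarrow> real mat" where
  "moment_mat n = mat 2 n (\<lambda>(i, j). real j ^ i)"

text \<open>The term 2nj makes the slope of every chord between neighbouring j, j+1 < n positive;
  the constant 1 keeps the intercept positive even for the chord at k = 0.\<close>

definition concave_obj :: "nat \<Rightarrow> real vec" where
  "concave_obj n = vec n (\<lambda>j. 1 + 2 * real n * real j - (real j)\<^sup>2)"

lemma design_moment: "design 2 n (moment_mat n) (concave_obj n)"
proof -
  have "0 \<le> 1 + 2 * real n * real j - (real j)\<^sup>2" if "j < n" for j
  proof -
    have "real j * real j \<le> real n * real j"
      using that by (intro mult_right_mono) auto
    moreover have "0 \<le> real n * real j" by simp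
    ultimately show ?thesis unfolding power2_eq_square by linarith
  qed
  then show ?thesis
    by (auto simp: design_def moment_mat_def concave_obj_def less_eq_vec_def)
qed

lemma all_less_2_iff: "(\<forall>i<2. P i) \<longleftrightarrow> P 0 \<and> P (1::nat)"
  by (auto simp: less_2_cases_iff)

lemma feasible_moment_iff:
  "z \<in> lp_feasible (moment_mat n) (vec 2 (\<lambda>i. if i = 0 then b1 else b2)) \<longleftrightarrow>
     dim_vec z = n \<and> (\<forall>j<n. 0 \<le> z $ j) \<and>
     (\<Sum>j<n. z $ j) \<le> b1 \<and> (\<Sum>j<n. real j * z $ j) \<le> b2"
proof -
  have dims: "dim_row (moment_mat n) = 2" "dim_col (moment_mat n) = n"
    by (simp_all add: moment_mat_def)
  have rows: "(moment_mat n *\<^sub>v z) $ 0 = (\<Sum>j<n. z $ j)"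
    "(moment_mat n *\<^sub>v z) $ 1 = (\<Sum>j<n. real j * z $ j)" if "dim_vec z = n"
    using that by (simp_all add: moment_mat_def scalar_prod_def atLeast0LessThan)
  have le: "moment_mat n *\<^sub>v z \<le> vec 2 (\<lambda>i. if i = 0 then b1 else b2) \<longleftrightarrow>
      (\<Sum>j<n. z $ j) \<le> b1 \<and> (\<Sum>j<n. real j * z $ j) \<le> b2" if "dim_vec z = n"
    unfolding less_eq_vec_def rows[OF that, symmetric] dim_vec all_less_2_iff
    by (simp add: dims del: index_mult_mat_vec)
  have nonneg: "0\<^sub>v n \<le> z \<longleftrightarrow> (\<forall>j<n. 0 \<le> z $ j)" if "dim_vec z = n"
    using that by (simp add: less_eq_vec_def)
  show ?thesis
    unfolding lp_feasible_def dims carrier_vec_def mem_Collect_eq using le nonneg by blast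
qed

text \<open>Coefficientwise this is chord minus excess. It needs no feasibility, so it serves both
  the optimality bound and the equality case.\<close>

lemma obj_eq_dual_minus_slack:
  assumes "dim_vec z = n"
  shows "concave_obj n \<bullet> z =
    (1 + real k * (real k + 1)) * (\<Sum>j<n. z $ j)
    + (2 * real n - 2 * real k - 1) * (\<Sum>j<n. real j * z $ j)
    - (\<Sum>j<n. (real j - real k) * (real j - real k - 1) * z $ j)"
proof -
  have "concave_obj n \<bullet> z = (\<Sum>j<n. (1 + real k * (real k + 1)) * z $ j
     + (2 * real n - 2 * real k - 1) * (real j * z $ j)
     - (real j - real k) * (real j - real k - 1) * z $ j)"
    using assms unfolding scalar_prod_def concave_obj_def atLeast0LessThan
    by (intro sum.cong) (auto simp: algebra_simps power2_eq_square)
  then show ?thesis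
    by (simp add: sum.distrib sum_subtractf sum_distrib_left)
qed

text \<open>No integer lies strictly between k and k+1, so the two factors have the same
  sign.\<close>

lemma consecutive_slack_pos:
  assumes "j \<noteq> k" "j \<noteq> Suc k"
  shows "0 < (real j - real k) * (real j - real k - 1)"
proof (cases "j < k")
  case True
  then show ?thesis by (intro mult_neg_neg) auto
next
  case False
  then have "Suc k < j" using assms by auto
  then have "real k + 1 < real j" by linarith
  then show ?thesis by (intro mult_pos_pos) auto
qed

lemma sum_supported_on_pair:
  fixes f :: "nat \<Rightarrow> real"
  assumes "Suc k < n" "\<And>j. j < n \<Longrightarrow> j \<noteq> k \<Longrightarrow> j \<noteq> Suc k \<Longrightarrow> f j = 0"
  shows "(\<Sum>j<n. f j) = f k + f (Suc k)"
proof -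
  have "(\<Sum>j<n. f j) = (\<Sum>j\<in>{k, Suc k}. f j)"
    using assms by (intro sum.mono_neutral_right) auto
  then show ?thesis by simp
qed

lemma loadout_consecutive:
  assumes k: "Suc k < n"
  shows "loadout (moment_mat n) (concave_obj n) {k, Suc k}"
proof -
  \<comment> \<open>This is the image of \<open>x\<close> under the matrix, so both rows are tight
    at \<open>x\<close>.\<close>
  define b where "b = vec 2 (\<lambda>i. if i = 0 then 2 else 2 * real k + 1)"
  define x where "x = vec n (\<lambda>j. if j = k \<or> j = Suc k then 1 else (0::real))"
  \<comment> \<open>Here \<open>q\<close> is the slope of the chord from k to k+1 and
    \<open>p\<close> its intercept.\<close>
  define p where "p = 1 + real k * (real k + 1)"
  define q where "q = 2 * real n - 2 * real k - 1"
  define g where "g j = (real j - real k) * (real j - real k - 1)" for j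
  have p: "0 < p" unfolding p_def by (intro add_pos_nonneg) auto
  have q: "0 < q" using k unfolding q_def by linarith
  have g: "0 \<le> g j" for j
    using consecutive_slack_pos[of j k] by (cases "j = k \<or> j = Suc k") (auto simp: g_def)
  note feas = feasible_moment_iff[of _ n 2 "2 * real k + 1", folded b_def]
  note obj = obj_eq_dual_minus_slack[of _ n k, folded p_def q_def g_def]
  have xj: "x $ j = (if j = k \<or> j = Suc k then 1 else 0)" if "j < n" for j
    using that by (simp add: x_def)
  have x_dim: "dim_vec x = n" by (simp add: x_def)
  have x_row1: "(\<Sum>j<n. x $ j) = 2"
    using k by (subst sum_supported_on_pair[of k]) (auto simp: xj)
  have x_row2: "(\<Sum>j<n. real j * x $ j) = 2 * real k + 1"
    using k by (subst sum_supported_on_pair[of k]) (auto simp: xj)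
  have x_slack: "(\<Sum>j<n. g j * x $ j) = 0"
    by (intro sum.neutral) (auto simp: xj g_def)
  have x_feas: "x \<in> lp_feasible (moment_mat n) b"
    using x_row1 x_row2 by (auto simp: feas x_dim xj)
  have x_obj: "concave_obj n \<bullet> x = p * 2 + q * (2 * real k + 1)"
    by (simp add: obj x_dim x_row1 x_row2 x_slack)
  \<comment> \<open>The gap to the objective at \<open>x\<close> is \<open>p\<close> and
    \<open>q\<close> times the slacks of the two rows plus the \<open>g\<close>-weighted sum of
    \<open>z\<close>: three nonnegative terms.\<close>
  have bound: "concave_obj n \<bullet> z \<le> concave_obj n \<bullet> x \<and>
      (concave_obj n \<bullet> z = concave_obj n \<bullet> x \<longrightarrow> z = x)"
    if z: "z \<in> lp_feasible (moment_mat n) b" for z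
  proof -
    have zd: "dim_vec z = n" and z0: "\<And>j. j < n \<Longrightarrow> 0 \<le> z $ j"
      and r1: "(\<Sum>j<n. z $ j) \<le> 2" and r2: "(\<Sum>j<n. real j * z $ j) \<le> 2 * real k + 1"
      using z by (auto simp: feas)
    have s0: "0 \<le> (\<Sum>j<n. g j * z $ j)"
      using g z0 by (intro sum_nonneg) auto
    have t1: "p * (\<Sum>j<n. z $ j) \<le> p * 2" using r1 p by simp
    have t2: "q * (\<Sum>j<n. real j * z $ j) \<le> q * (2 * real k + 1)" using r2 q by simp
    have le: "concave_obj n \<bullet> z \<le> concave_obj n \<bullet> x"
      using s0 t1 t2 unfolding x_obj obj[OF zd] by linarith
    have "z = x" if eq: "concave_obj n \<bullet> z = concave_obj n \<bullet> x"
    proof -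
      \<comment> \<open>A zero gap makes all three terms vanish; as \<open>p\<close> and
        \<open>q\<close> are positive, both rows are tight at \<open>z\<close>.\<close>
      have s: "(\<Sum>j<n. g j * z $ j) = 0"
        and "p * (\<Sum>j<n. z $ j) = p * 2"
        and "q * (\<Sum>j<n. real j * z $ j) = q * (2 * real k + 1)"
        using s0 t1 t2 eq unfolding x_obj obj[OF zd] by linarith+
      then have e1: "(\<Sum>j<n. z $ j) = 2" and e2: "(\<Sum>j<n. real j * z $ j) = 2 * real k + 1"
        using p q by (simp_all del: mult_cancel_left add: mult_left_cancel)
      have "\<forall>j\<in>{..<n}. g j * z $ j = 0"
        using s g z0 by (subst (asm) sum_nonneg_eq_0_iff) auto
      then have off: "z $ j = 0" if "j < n" "j \<noteq> k" "j \<noteq> Suc k" for j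
        using that consecutive_slack_pos[of j k] by (auto simp: g_def)
      have "z $ k + z $ Suc k = 2"
        using e1 k off by (subst (asm) sum_supported_on_pair[of k]) auto
      moreover have "real k * z $ k + real (Suc k) * z $ Suc k = 2 * real k + 1"
        using e2 k off by (subst (asm) sum_supported_on_pair[of k]) auto
      \<comment> \<open>Subtracting k times the first equation from the second isolates
        \<open>z $ Suc k\<close>.\<close>
      moreover have "real k * z $ k + real (Suc k) * z $ Suc k
          = real k * (z $ k + z $ Suc k) + z $ Suc k"
        by (simp add: algebra_simps)
      ultimately have "z $ k = 1" "z $ Suc k = 1" by auto
      then show "z = x"
        using off zd x_dim by (intro eq_vecI) (auto simp: xj)
    qed
    with le show ?thesis by blast
  qed
  have "lp_optimal (moment_mat n) (concave_obj n) b x"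
    using x_feas bound by (auto simp: lp_optimal_def)
  moreover have "y = x" if "lp_optimal (moment_mat n) (concave_obj n) b y" for y
    using that x_feas bound by (force simp: lp_optimal_def)
  moreover have "supp x = {k, Suc k}"
    using k by (auto simp: supp_def x_dim xj split: if_splits)
  moreover have "b \<in> carrier_vec (dim_row (moment_mat n))" "0\<^sub>v (dim_row (moment_mat n)) \<le> b"
    by (auto simp: b_def moment_mat_def less_eq_vec_def)
  moreover have "{k, Suc k} \<subseteq> {0..<dim_col (moment_mat n)}"
    using k by (simp add: moment_mat_def)
  ultimately show ?thesis unfolding loadout_def by blast
qed

text \<open>Needed for the counting: \<open>card\<close> of an infinite set is 0, so a lower bound
  by a subset requires finiteness.\<close>

lemma finite_k_loadouts: "finite (k_loadouts k A c)"
  by (rule finite_subset[of _ "Pow {0..<dim_col A}"]) (auto simp: k_loadouts_def loadout_def)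

theorem theorem4:
  fixes n :: nat
  assumes "n > 2"
  shows "\<exists>A c. design 2 n A c \<and> card (k_loadouts 2 A c) \<ge> n - 1"
proof -
  \<comment> \<open>Sets are unordered, but a swapped match would need both k = k'+1 and k' =
    k+1.\<close>
  have inj: "inj_on (\<lambda>k. {k, Suc k}) {..<n - 1}"
    by (auto simp: inj_on_def doubleton_eq_iff)
  have "(\<lambda>k. {k, Suc k}) ` {..<n - 1} \<subseteq> k_loadouts 2 (moment_mat n) (concave_obj n)"
    using loadout_consecutive by (auto simp: k_loadouts_def)
  from card_mono[OF finite_k_loadouts this]
  have "n - 1 \<le> card (k_loadouts 2 (moment_mat n) (concave_obj n))"
    unfolding card_image[OF inj] by simp
  with design_moment show ?thesis by blast
qed

end
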